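(* Let $m\geq 3$ and $n\geq 2$ be integers. Then $\chi_L(K_m\square P_n)=m+2$ if $m\leq n-2$, and $\chi_L(K_m\square P_n)=m+1$ if $m\geq n-1$.
   Context: $K_m$ is the complete graph on $m$ vertices, $P_n$ the path on $n$ vertices, and $\square$ the cartesian product: $V(G\square H)=V(G)\times V(H)$, with $(a,b)\sim(a',b')$ iff ($a=a'$ and $bb'\in E(H)$) or ($aa'\in E(G)$ and $b=b'$). For a connected graph $G$, with $d$ the shortest-path distance and $d(v,S)=\min_{x\in S}d(v,x)$, a proper $k$-coloring (onto $\{1,\dots,k\}$) with ordered color classes $(V_1,\dots,V_k)$ is a locating coloring if distinct vertices $v$ have distinct color codes $(d(v,V_1),\dots,d(v,V_k))$; $\chi_L(G)$, the locating chromatic number, is the minimum $k$ for which a locating $k$-coloring exists. *)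

theory Defs
  imports "Graph_Theory.Graph_Theory"
begin

text \<open>
  Simple graphs are loop-free symmetric digraphs without parallel arcs, i.e. instances of
  \<^locale>\<open>pair_graph\<close>; an undirected edge is a pair of opposite arcs.
\<close>

definition complete_graph :: "nat \<Rightarrow> nat pair_pre_digraph" where
  "complete_graph m = \<lparr>pverts = {1..m}, parcs = {(a, b). a \<in> {1..m} \<and> b \<in> {1..m} \<and> a \<noteq> b}\<rparr>"

definition path_graph :: "nat \<Rightarrow> nat pair_pre_digraph" where
  "path_graph n = \<lparr>pverts = {1..n},
     parcs = {(a, b). a \<in> {1..n} \<and> b \<in> {1..n} \<and> (b = Suc a \<or> a = Suc b)}\<rparr>"

definition cartesian_product ::
  "'a pair_pre_digraph \<Rightarrow> 'b pair_pre_digraph \<Rightarrow> ('a \<times> 'b) pair_pre_digraph"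
  (infixr \<open>\<box>\<close> 70) where
  "G \<box> H = \<lparr>pverts = pverts G \<times> pverts H,
     parcs = {((a, b), (a', b')).
       (a \<in> pverts G \<and> a = a' \<and> (b, b') \<in> parcs H) \<or>
       ((a, a') \<in> parcs G \<and> b \<in> pverts H \<and> b = b')}\<rparr>"

text \<open>
  Every arc has weight 1, so that the cost of a walk is its length.
\<close>

definition graph_dist :: "'a pair_pre_digraph \<Rightarrow> 'a \<Rightarrow> 'a \<Rightarrow> ereal" where
  "graph_dist G = wf_digraph.\<mu> (with_proj G) (\<lambda>_. 1)"

definition dist_to_set :: "'a pair_pre_digraph \<Rightarrow> 'a \<Rightarrow> 'a set \<Rightarrow> ereal" where
  "dist_to_set G v S = Min (graph_dist G v ` S)"

definition proper_coloring :: "'a pair_pre_digraph \<Rightarrow> nat \<Rightarrow> ('a \<Rightarrow> nat) \<Rightarrow> bool" where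
  "proper_coloring G k c \<longleftrightarrow>
     c ` pverts G = {1..k} \<and> (\<forall>(u, v) \<in> parcs G. c u \<noteq> c v)"

definition color_class :: "'a pair_pre_digraph \<Rightarrow> ('a \<Rightarrow> nat) \<Rightarrow> nat \<Rightarrow> 'a set" where
  "color_class G c i = {v \<in> pverts G. c v = i}"

definition color_code :: "'a pair_pre_digraph \<Rightarrow> nat \<Rightarrow> ('a \<Rightarrow> nat) \<Rightarrow> 'a \<Rightarrow> ereal list" where
  "color_code G k c v = map (\<lambda>i. dist_to_set G v (color_class G c i)) [1..<Suc k]"

definition locating_coloring :: "'a pair_pre_digraph \<Rightarrow> nat \<Rightarrow> ('a \<Rightarrow> nat) \<Rightarrow> bool" where
  "locating_coloring G k c \<longleftrightarrow>
     proper_coloring G k c \<and> inj_on (color_code G k c) (pverts G)"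

text \<open>
  The minimum exists for every finite simple graph, see
  \<open>locating_coloring_exists\<close> below.
\<close>

definition locating_chromatic_number :: "'a pair_pre_digraph \<Rightarrow> nat" (\<open>\<chi>\<^sub>L\<close>) where
  "\<chi>\<^sub>L G = (LEAST k. \<exists>c. locating_coloring G k c)"


lemma pair_graphI:
  assumes "finite (pverts G)" "parcs G \<subseteq> pverts G \<times> pverts G" "sym (parcs G)" "irrefl (parcs G)"
  shows "pair_graph G"
proof -
  have "finite (parcs G)"
    using assms(1,2) by (meson finite_SigmaI finite_subset)
  then show ?thesis
    using assms by unfold_locales (auto simp: symmetric_def irrefl_def)
qed

lemma pair_graph_complete_graph: "pair_graph (complete_graph m)"
  by (rule pair_graphI) (auto simp: complete_graph_def sym_def irrefl_def)

lemma complete_digraph_complete_graph: "complete_digraph m (with_proj (complete_graph m))"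
  by (auto simp: complete_digraph_pair_def complete_graph_def)

lemma pair_graph_path_graph: "pair_graph (path_graph n)"
  by (rule pair_graphI) (auto simp: path_graph_def sym_def irrefl_def)

lemma pair_graph_cartesian_product:
  assumes "pair_graph G" "pair_graph H"
  shows "pair_graph (G \<box> H)"
proof -
  interpret G: pair_graph G by fact
  interpret H: pair_graph H by fact
  have "sym (parcs G)" "sym (parcs H)"
    using G.pair_sym_arcs H.pair_sym_arcs by (auto simp: symmetric_def)
  then show ?thesis
    using G.pair_finite_verts H.pair_finite_verts
    by (intro pair_graphI)
      (auto simp: cartesian_product_def sym_def irrefl_def
        dest: G.wellformed' H.wellformed' G.pair_no_loops H.pair_no_loops)
qed

lemma graph_dist_eq_INF:
  assumes "pair_graph G"
  shows "graph_dist G u v =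
    (INF p \<in> {p. pre_digraph.awalk (with_proj G) u p v}. ereal (real (length p)))"
proof -
  interpret pair_graph G by fact
  have "awalk_cost (\<lambda>_. 1) p = real (length p)" for p :: "('a \<times> 'a) list"
    by (induction p) auto
  then show ?thesis
    unfolding graph_dist_def \<mu>_def by simp
qed

lemma graph_dist_self:
  assumes "pair_graph G" "v \<in> pverts G"
  shows "graph_dist G v v = 0"
proof -
  interpret pair_graph G by fact
  have "awalk v [] v"
    using assms(2) by (simp add: awalk_Nil_iff)
  then have "graph_dist G v v \<le> 0"
    unfolding graph_dist_eq_INF[OF assms(1)] by (intro INF_lower2[of "[]"]) auto
  moreover have "graph_dist G v v \<ge> 0"
    unfolding graph_dist_eq_INF[OF assms(1)] by (intro INF_greatest) auto
  ultimately show ?thesis by simp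
qed

lemma graph_dist_ge_1:
  assumes "pair_graph G" "u \<noteq> v"
  shows "graph_dist G u v \<ge> 1"
proof -
  interpret pair_graph G by fact
  have "length p \<ge> 1" if "awalk u p v" for p
    using that assms(2) by (cases p) (auto simp: awalk_Nil_iff)
  then show ?thesis
    unfolding graph_dist_eq_INF[OF assms(1)]
    by (intro INF_greatest) (simp add: one_ereal_def)
qed

lemma locating_coloring_exists:
  assumes "pair_graph G"
  shows "\<exists>k c. locating_coloring G k c"
proof -
  interpret pair_graph G by fact
  obtain c where "bij_betw c (pverts G) {1..card (pverts G)}"
    using finite_same_card_bij[OF pair_finite_verts, of "{1..card (pverts G)}"] by auto
  then have img: "c ` pverts G = {1..card (pverts G)}" and inj: "inj_on c (pverts G)"
    by (auto simp: bij_betw_def)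
  have entry: "color_code G (card (pverts G)) c u ! (c v - 1) = graph_dist G u v"
    if "v \<in> pverts G" for u v
  proof -
    have "c v \<in> {1..card (pverts G)}" using img that by blast
    moreover have "color_class G c (c v) = {v}"
      using inj that by (auto simp: color_class_def inj_on_def)
    ultimately show ?thesis
      by (auto simp: color_code_def dist_to_set_def nth_append simp del: upt_Suc)
  qed
  have "inj_on (color_code G (card (pverts G)) c) (pverts G)"
  proof (rule inj_onI, rule ccontr)
    fix u v assume uv: "u \<in> pverts G" "v \<in> pverts G" "u \<noteq> v"
      and "color_code G (card (pverts G)) c u = color_code G (card (pverts G)) c v"
    then have "graph_dist G u v = graph_dist G v v"
      using entry[of v u] entry[of v v] by simp
    then show False
      using graph_dist_self[OF assms uv(2)] graph_dist_ge_1[OF assms uv(3)] by simp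
  qed
  moreover have "proper_coloring G (card (pverts G)) c"
  proof -
    have "c u \<noteq> c v" if "(u, v) \<in> parcs G" for u v
      using inj_onD[OF inj, of u v] wellformed'[OF that] pair_no_loops[OF that] by auto
    then show ?thesis
      using img by (auto simp: proper_coloring_def)
  qed
  ultimately show ?thesis
    unfolding locating_coloring_def by blast
qed

lemma connected_complete_path:
  assumes "m \<ge> 1" "n \<ge> 1"
  shows "strongly_connected (with_proj (complete_graph m \<box> path_graph n))"
proof -
  let ?G = "complete_graph m \<box> path_graph n"
  interpret pair_graph ?G
    by (intro pair_graph_cartesian_product pair_graph_complete_graph pair_graph_path_graph)
  have verts: "pverts ?G = {1..m} \<times> {1..n}"
    by (simp add: cartesian_product_def complete_graph_def path_graph_def)
  have arc: "u \<rightarrow>\<^sup>*\<^bsub>with_proj ?G\<^esub> v" if "(u, v) \<in> parcs ?G" for u v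
    using that by (intro reachable_adjI) simp
  have refl: "v \<rightarrow>\<^sup>*\<^bsub>with_proj ?G\<^esub> v" if "v \<in> pverts ?G" for v
    using that by (rule reachable_refl)
  have base: "(a, Suc j) \<rightarrow>\<^sup>*\<^bsub>with_proj ?G\<^esub> (a, 1)" if "a \<in> {1..m}" "Suc j \<in> {1..n}" for a j
    using that(2)
  proof (induction j)
    case 0
    show ?case
      using refl[of "(a, 1)"] that(1) assms unfolding verts by simp
  next
    case (Suc j)
    have "(a, Suc (Suc j)) \<rightarrow>\<^sup>*\<^bsub>with_proj ?G\<^esub> (a, Suc j)"
      using that(1) Suc.prems
      by (intro arc) (simp add: cartesian_product_def complete_graph_def path_graph_def)
    moreover have "(a, Suc j) \<rightarrow>\<^sup>*\<^bsub>with_proj ?G\<^esub> (a, 1)"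
      using Suc by simp
    ultimately show ?case
      by (rule reachable_trans)
  qed
  have corner: "(a, 1) \<rightarrow>\<^sup>*\<^bsub>with_proj ?G\<^esub> (1, 1)" if "a \<in> {1..m}" for a
  proof (cases "a = 1")
    case True
    then show ?thesis
      using refl[of "(1, 1)"] assms unfolding verts by simp
  next
    case False
    then show ?thesis
      using that assms
      by (intro arc) (simp add: cartesian_product_def complete_graph_def path_graph_def)
  qed
  have to_corner: "v \<rightarrow>\<^sup>*\<^bsub>with_proj ?G\<^esub> (1, 1)" if vert: "v \<in> pverts ?G" for v
  proof -
    obtain a b where v: "v = (a, b)" "a \<in> {1..m}" "b \<in> {1..n}"
      using vert unfolding verts by blast
    moreover obtain j where "b = Suc j"
      using v(3) by (cases b) auto
    ultimately have "v \<rightarrow>\<^sup>*\<^bsub>with_proj ?G\<^esub> (a, 1)"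
      using base by blast
    then show ?thesis
      using corner[OF v(2)] by (rule reachable_trans)
  qed
  have from_corner: "(1, 1) \<rightarrow>\<^sup>*\<^bsub>with_proj ?G\<^esub> v" if "v \<in> pverts ?G" for v
    using symmetric_reachable[OF pair_sym_arcs to_corner[OF that]] .
  show ?thesis
  proof (rule strongly_connectedI)
    have "(1, 1) \<in> pverts ?G"
      using assms unfolding verts by simp
    then show "verts (with_proj ?G) \<noteq> {}"
      unfolding with_proj_simps by blast
    show "u \<rightarrow>\<^sup>*\<^bsub>with_proj ?G\<^esub> v"
      if "u \<in> verts (with_proj ?G)" "v \<in> verts (with_proj ?G)" for u v
      using that reachable_trans[OF to_corner from_corner] by simp
  qed
qed

end

theory Submission
  imports Defs
begin

text \<open>
  With only \<open>m\<close> colours every layer \<open>K\<^sub>m\<close> shows all of them and the code of a vertex depends on its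
  colour alone. With \<open>m + 1\<close> colours every layer misses exactly one colour. If two consecutive
  layers missed the same colour, then the next layer on either side would have to miss it as well,
  since otherwise two vertices of equal colour would have distance 2 from the missing one; so that
  colour would never occur. Hence every layer contains a vertex adjacent to all other colours, and
  these vertices must have distinct colours, which bounds the number \<open>n\<close> of layers by \<open>m + 1\<close>.
  Cyclic colourings show that these bounds are attained.
\<close>

section \<open>Distances to colour classes\<close>

lemma dist_to_set_le:
  assumes "pair_graph G" "finite S" "t \<in> S" "pre_digraph.awalk (with_proj G) v p t"
  shows "dist_to_set G v S \<le> ereal (real (length p))"
proof -
  have "dist_to_set G v S \<le> graph_dist G v t"
    unfolding dist_to_set_def using assms(2,3) by (intro Min_le) auto
  also have "\<dots> \<le> ereal (real (length p))"
    unfolding graph_dist_eq_INF[OF assms(1)] using assms(4) by (intro INF_lower) simp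
  finally show ?thesis .
qed

text \<open>Nonemptiness of \<open>S\<close> matters because \<open>Min\<close> of the empty set is
  unspecified.\<close>

lemma dist_to_set_ge:
  assumes "pair_graph G" "finite S" "S \<noteq> {}"
    and "\<And>t p. t \<in> S \<Longrightarrow> pre_digraph.awalk (with_proj G) v p t \<Longrightarrow> l \<le> length p"
  shows "ereal (real l) \<le> dist_to_set G v S"
proof -
  have "ereal (real l) \<le> graph_dist G v t" if "t \<in> S" for t
    unfolding graph_dist_eq_INF[OF assms(1)] using assms(4)[OF that] by (intro INF_greatest) simp
  then show ?thesis
    unfolding dist_to_set_def using assms(2,3) by (subst Min_ge_iff) auto
qed

text \<open>A certificate for distances: \<open>lip\<close> makes every walk into \<open>S\<close>
  have at least \<open>\<phi> v\<close> arcs, by induction along the walk, while \<open>desc\<close>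
  allows a walk along which \<open>\<phi>\<close> drops at each arc until it vanishes, that is,
  until \<open>S\<close> is reached.\<close>

lemma dist_to_set_eq_potential:
  fixes \<phi> :: "'a \<Rightarrow> nat"
  assumes G: "pair_graph G" and "finite S" "v \<in> pverts G"
    and zero: "\<And>u. u \<in> pverts G \<Longrightarrow> \<phi> u = 0 \<longleftrightarrow> u \<in> S"
    and lip: "\<And>u w. (u, w) \<in> parcs G \<Longrightarrow> \<phi> u \<le> Suc (\<phi> w)"
    and desc: "\<And>u. u \<in> pverts G \<Longrightarrow> \<phi> u > 0 \<Longrightarrow> \<exists>w. (u, w) \<in> parcs G \<and> \<phi> w < \<phi> u"
  shows "dist_to_set G v S = ereal (real (\<phi> v))"
proof -
  interpret pair_graph G by (rule G)
  have lower: "\<phi> u \<le> length p" if "awalk u p t" "t \<in> S" for u p t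
    using that
  proof (induction p arbitrary: u)
    case Nil
    then show ?case using zero by (auto simp: awalk_Nil_iff)
  next
    case (Cons e p)
    then have "e \<in> parcs G" "u = fst e" "\<phi> (snd e) \<le> length p"
      by (auto simp: awalk_Cons_iff)
    then show ?case using lip[of "fst e" "snd e"] by auto
  qed
  have upper: "\<exists>t\<in>S. \<exists>p. awalk u p t \<and> length p \<le> \<phi> u" if "u \<in> pverts G" for u
    using that
  proof (induction "\<phi> u" arbitrary: u rule: less_induct)
    case less
    show ?case
    proof (cases "\<phi> u = 0")
      case True
      have "awalk u [] u" using less.prems by (simp add: awalk_Nil_iff)
      then show ?thesis using True zero[OF less.prems] by force
    next
      case False
      then obtain w where w: "(u, w) \<in> parcs G" "\<phi> w < \<phi> u"
        using desc[OF less.prems] by auto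
      then obtain t p where tp: "t \<in> S" "awalk w p t" "length p \<le> \<phi> w"
        using less.hyps[of w] wellformed'[of u w] by auto
      then have "awalk u ((u, w) # p) t" using w by (simp add: awalk_Cons_iff)
      then show ?thesis using tp w by (intro bexI[of _ t] exI[of _ "(u, w) # p"]) auto
    qed
  qed
  obtain t p where tp: "t \<in> S" "awalk v p t" "length p \<le> \<phi> v"
    using upper[OF assms(3)] by blast
  have "ereal (real (\<phi> v)) \<le> dist_to_set G v S"
    using tp lower by (intro dist_to_set_ge[OF G assms(2)]) auto
  moreover have "dist_to_set G v S \<le> ereal (real (\<phi> v))"
    using dist_to_set_le[OF G assms(2) tp(1,2)] tp(3) by (simp add: order_trans)
  ultimately show ?thesis by (rule antisym[rotated])
qed

lemma finite_color_class:
  assumes "pair_graph G"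
  shows "finite (color_class G c i)"
proof -
  interpret pair_graph G by fact
  show ?thesis using pair_finite_verts by (simp add: color_class_def)
qed

lemma dist_color_self:
  assumes "pair_graph G" "v \<in> pverts G"
  shows "dist_to_set G v (color_class G c (c v)) = 0"
proof -
  interpret pair_graph G by fact
  have v: "v \<in> color_class G c (c v)" using assms(2) by (simp add: color_class_def)
  have "awalk v [] v" using assms(2) by (simp add: awalk_Nil_iff)
  then have "dist_to_set G v (color_class G c (c v)) \<le> 0"
    using dist_to_set_le[OF assms(1) finite_color_class[OF assms(1)] v, of v "[]"] by (simp add: zero_ereal_def)
  moreover have "0 \<le> dist_to_set G v (color_class G c (c v))"
    using dist_to_set_ge[OF assms(1) finite_color_class[OF assms(1)], of c "c v" v 0] v
    by (auto simp: zero_ereal_def)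
  ultimately show ?thesis by (rule antisym)
qed

lemma dist_color_eq_1:
  assumes "pair_graph G" "(v, u) \<in> parcs G" "c v \<noteq> c u"
  shows "dist_to_set G v (color_class G c (c u)) = 1"
proof -
  interpret pair_graph G by fact
  have u: "u \<in> color_class G c (c u)"
    using wellformed'[OF assms(2)] by (simp add: color_class_def)
  have "awalk v [(v, u)] u"
    using assms(2) wellformed'[OF assms(2)] by (simp add: awalk_Cons_iff awalk_Nil_iff)
  then have "dist_to_set G v (color_class G c (c u)) \<le> 1"
    using dist_to_set_le[OF assms(1) finite_color_class[OF assms(1)] u, of v "[(v, u)]"]
    by (simp add: one_ereal_def)
  moreover have "1 \<le> length p" if "t \<in> color_class G c (c u)" "awalk v p t" for t p
    using that assms(3) by (cases p) (auto simp: color_class_def awalk_Nil_iff)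
  then have "1 \<le> dist_to_set G v (color_class G c (c u))"
    using dist_to_set_ge[OF assms(1) finite_color_class[OF assms(1)], of c "c u" v 1] u
    by (auto simp: one_ereal_def)
  ultimately show ?thesis by (rule antisym)
qed

lemma dist_color_ge_2:
  assumes "pair_graph G" "color_class G c i \<noteq> {}" "c v \<noteq> i"
    and "\<And>u. (v, u) \<in> parcs G \<Longrightarrow> c u \<noteq> i"
  shows "2 \<le> dist_to_set G v (color_class G c i)"
proof -
  interpret pair_graph G by fact
  have "2 \<le> length p" if "t \<in> color_class G c i" "awalk v p t" for t p
  proof -
    \<comment> \<open>The case rule of \<open>remdups_adj\<close> splits a list exactly into empty,
      singleton and at least two elements.\<close>
    consider "p = []" | e where "p = [e]" | "2 \<le> length p"
      by (cases p rule: remdups_adj.cases) auto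
    then show ?thesis
      using that assms(3) assms(4)[of t]
      by cases (auto simp: color_class_def awalk_Cons_iff awalk_Nil_iff)
  qed
  then show ?thesis
    using dist_to_set_ge[OF assms(1) finite_color_class[OF assms(1)] assms(2), of v 2] by simp
qed

lemma dist_color_eq_2:
  assumes "pair_graph G" "(v, w) \<in> parcs G" "(w, u) \<in> parcs G" "c v \<noteq> c u"
    and "\<And>x. (v, x) \<in> parcs G \<Longrightarrow> c x \<noteq> c u"
  shows "dist_to_set G v (color_class G c (c u)) = 2"
proof -
  interpret pair_graph G by fact
  have u: "u \<in> color_class G c (c u)"
    using wellformed'[OF assms(3)] by (simp add: color_class_def)
  have "awalk v [(v, w), (w, u)] u"
    using assms(2,3) wellformed'[OF assms(3)] by (simp add: awalk_Cons_iff awalk_Nil_iff)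
  then have "dist_to_set G v (color_class G c (c u)) \<le> 2"
    using dist_to_set_le[OF assms(1) finite_color_class[OF assms(1)] u, of v "[(v, w), (w, u)]"]
    by simp
  moreover have "2 \<le> dist_to_set G v (color_class G c (c u))"
    using u assms by (intro dist_color_ge_2) auto
  ultimately show ?thesis by (rule antisym)
qed

lemma color_code_eq_iff:
  "color_code G k c u = color_code G k c v \<longleftrightarrow>
    (\<forall>i\<in>{1..k}. dist_to_set G u (color_class G c i) = dist_to_set G v (color_class G c i))"
  unfolding color_code_def map_eq_conv by auto

text \<open>The coordinate at \<open>c u\<close> is zero for \<open>u\<close> and at least 1 for
  every vertex of another colour, so the code determines the colour.\<close>

lemma color_eq_of_code_eq:
  assumes "pair_graph G" "proper_coloring G k c" "u \<in> pverts G" "v \<in> pverts G"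
    and "color_code G k c u = color_code G k c v"
  shows "c u = c v"
proof (rule ccontr)
  assume neq: "c u \<noteq> c v"
  interpret pair_graph G by fact
  have "c u \<in> {1..k}" using assms(2,3) by (auto simp: proper_coloring_def)
  then have "dist_to_set G v (color_class G c (c u)) = 0"
    using assms(5) dist_color_self[OF assms(1,3), of c] unfolding color_code_eq_iff by auto
  moreover have "ereal (real 1) \<le> dist_to_set G v (color_class G c (c u))"
  proof (rule dist_to_set_ge[OF assms(1) finite_color_class[OF assms(1)]])
    show "color_class G c (c u) \<noteq> {}" using assms(3) by (auto simp: color_class_def)
    fix t p assume "t \<in> color_class G c (c u)" "awalk v p t"
    then show "1 \<le> length p"
      using neq by (cases p) (auto simp: color_class_def awalk_Nil_iff)
  qed
  ultimately show False by simp
qed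

section \<open>Colourings of the product\<close>

lemma pair_graph_complete_path: "pair_graph (complete_graph m \<box> path_graph n)"
  by (intro pair_graph_cartesian_product pair_graph_complete_graph pair_graph_path_graph)

lemma pverts_complete_path: "pverts (complete_graph m \<box> path_graph n) = {1..m} \<times> {1..n}"
  by (simp add: cartesian_product_def complete_graph_def path_graph_def)

lemma parcs_complete_path:
  "((a, b), (a', b')) \<in> parcs (complete_graph m \<box> path_graph n) \<longleftrightarrow>
    a \<in> {1..m} \<and> a' \<in> {1..m} \<and> b \<in> {1..n} \<and> b' \<in> {1..n} \<and>
    (a = a' \<and> (b' = Suc b \<or> b = Suc b') \<or> a \<noteq> a' \<and> b = b')"
  by (auto simp: cartesian_product_def complete_graph_def path_graph_def)

lemma image_eq_insert_missing:
  fixes g :: "nat \<Rightarrow> nat"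
  assumes "inj_on g {1..m}" "g ` {1..m} \<subseteq> {1..m + 1} - {j}" "j \<in> {1..m + 1}"
  shows "g ` {1..m} = {1..m + 1} - {j}"
  using assms by (intro card_subset_eq) (auto simp: card_image)

lemma proper_coloring_layer_inj:
  assumes "proper_coloring (complete_graph m \<box> path_graph n) k c" "b \<in> {1..n}"
  shows "inj_on (\<lambda>a. c (a, b)) {1..m}"
proof (rule inj_onI, rule ccontr)
  fix a a' assume "a \<in> {1..m}" "a' \<in> {1..m}" "c (a, b) = c (a', b)" "a \<noteq> a'"
  then have "((a, b), (a', b)) \<in> parcs (complete_graph m \<box> path_graph n)"
    using assms(2) by (simp add: parcs_complete_path)
  then show False
    using assms(1) \<open>c (a, b) = c (a', b)\<close> unfolding proper_coloring_def by blast
qed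

text \<open>Colours below are residues modulo \<open>m + 1\<close>; they are told apart by placing
  the representatives less than \<open>m + 1\<close> from each other.\<close>

lemma mod_neq_of_less:
  fixes x y :: nat
  assumes "x < y" "y < x + M"
  shows "x mod M \<noteq> y mod M"
proof
  assume "x mod M = y mod M"
  then have "M dvd y - x" using assms(1) by (metis mod_eq_dvd_iff_nat less_imp_le)
  then have "M \<le> y - x" using assms(1) by (intro dvd_imp_le) auto
  then show False using assms by simp
qed

section \<open>Lower bounds\<close>

text \<open>A layer is a clique, so \<open>k\<close> is at least \<open>m\<close>. If
  \<open>k = m\<close>, every vertex has distance 1 to each colour other than its own.\<close>

lemma locating_coloring_ge:
  assumes "m \<ge> 1" "n \<ge> 2" and loc: "locating_coloring (complete_graph m \<box> path_graph n) k c"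
  shows "m + 1 \<le> k"
proof (rule ccontr)
  let ?G = "complete_graph m \<box> path_graph n"
  assume "\<not> m + 1 \<le> k"
  have proper: "proper_coloring ?G k c" and inj: "inj_on (color_code ?G k c) (pverts ?G)"
    using loc by (auto simp: locating_coloring_def)
  have im: "(\<lambda>a. c (a, b)) ` {1..m} \<subseteq> {1..k}" if "b \<in> {1..n}" for b
    using proper that by (auto simp: proper_coloring_def pverts_complete_path)
  have "m \<le> k"
    using card_mono[OF _ im[of 1]] proper_coloring_layer_inj[OF proper, of 1] assms
    by (simp add: card_image)
  then have k: "k = m" using \<open>\<not> m + 1 \<le> k\<close> by simp
  have layer: "(\<lambda>a. c (a, b)) ` {1..m} = {1..k}" if "b \<in> {1..n}" for b
    using im[OF that] proper_coloring_layer_inj[OF proper that] k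
    by (intro card_subset_eq) (auto simp: card_image)
  have dist: "dist_to_set ?G (a, b) (color_class ?G c i) = (if i = c (a, b) then 0 else 1)"
    if dom: "a \<in> {1..m}" "b \<in> {1..n}" "i \<in> {1..k}" for a b i
  proof (cases "i = c (a, b)")
    case True
    then show ?thesis
      using dist_color_self[OF pair_graph_complete_path] dom by (simp add: pverts_complete_path)
  next
    case False
    have "i \<in> (\<lambda>a. c (a, b)) ` {1..m}" using layer[OF dom(2)] dom(3) by blast
    then obtain a' where "a' \<in> {1..m}" "c (a', b) = i" by auto
    then show ?thesis
      using dist_color_eq_1[OF pair_graph_complete_path, of "(a, b)" "(a', b)" m n c] False dom
      by (auto simp: parcs_complete_path)
  qed
  \<comment> \<open>Colour 1 occurs in layers 1 and 2, which gives two vertices with the same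
    code.\<close>
  have "1 \<in> (\<lambda>a. c (a, 1)) ` {1..m}" "1 \<in> (\<lambda>a. c (a, 2)) ` {1..m}"
    using layer[of 1] layer[of 2] k assms by simp_all
  then obtain a a' where a: "a \<in> {1..m}" "c (a, 1) = 1" and a': "a' \<in> {1..m}" "c (a', 2) = 1"
    by fastforce
  have "color_code ?G k c (a, 1) = color_code ?G k c (a', 2)"
    unfolding color_code_eq_iff using dist[of a 1] dist[of a' 2] a a' assms by simp
  then have "(a, 1::nat) = (a', 2)"
    using a a' assms by (intro inj_onD[OF inj]) (auto simp: pverts_complete_path)
  then show False by simp
qed

section \<open>Colourings with \<open>m + 1\<close> colours: bounding the number of layers\<close>

locale almost_full_coloring =
  fixes m n :: nat and c :: "nat \<times> nat \<Rightarrow> nat"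
  assumes m_ge: "m \<ge> 3" and n_ge: "n \<ge> 2"
    and loc: "locating_coloring (complete_graph m \<box> path_graph n) (m + 1) c"
begin

abbreviation "G \<equiv> complete_graph m \<box> path_graph n"

lemma proper: "proper_coloring G (m + 1) c"
  using loc by (simp add: locating_coloring_def)

lemma c_range: "a \<in> {1..m} \<Longrightarrow> b \<in> {1..n} \<Longrightarrow> c (a, b) \<in> {1..m + 1}"
  using proper imageI[of "(a, b)" "pverts G" c] by (simp add: proper_coloring_def pverts_complete_path)

text \<open>For a layer \<open>b\<close> in \<open>{1..n}\<close> the colour is unique, and it
  exists since the \<open>m\<close> vertices of the layer have distinct colours among
  \<open>m + 1\<close>.\<close>

definition miss :: "nat \<Rightarrow> nat" where
  "miss b = (SOME j. j \<in> {1..m + 1} \<and> (\<lambda>a. c (a, b)) ` {1..m} = {1..m + 1} - {j})"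

lemma miss:
  assumes "b \<in> {1..n}"
  shows "miss b \<in> {1..m + 1}" "(\<lambda>a. c (a, b)) ` {1..m} = {1..m + 1} - {miss b}"
proof -
  let ?I = "(\<lambda>a. c (a, b)) ` {1..m}"
  have inj: "inj_on (\<lambda>a. c (a, b)) {1..m}" by (rule proper_coloring_layer_inj[OF proper assms])
  have "card ?I < card {1..m + 1}" using inj by (simp add: card_image)
  moreover have "?I \<subseteq> {1..m + 1}" using c_range assms by blast
  ultimately obtain j where "j \<in> {1..m + 1}" "j \<notin> ?I"
    by (metis less_irrefl subset_antisym subset_iff)
  then have "j \<in> {1..m + 1} \<and> ?I = {1..m + 1} - {j}"
    using \<open>?I \<subseteq> {1..m + 1}\<close> by (intro conjI image_eq_insert_missing inj) auto
  then have "miss b \<in> {1..m + 1} \<and> ?I = {1..m + 1} - {miss b}"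
    unfolding miss_def by (rule someI)
  then show "miss b \<in> {1..m + 1}" "?I = {1..m + 1} - {miss b}" by auto
qed

lemma ex_column:
  assumes "b \<in> {1..n}" "i \<in> {1..m + 1}" "i \<noteq> miss b"
  obtains a where "a \<in> {1..m}" "c (a, b) = i"
proof -
  have "i \<in> (\<lambda>a. c (a, b)) ` {1..m}" using miss(2)[OF assms(1)] assms(2,3) by simp
  then show ?thesis using that by auto
qed

lemma c_neq_miss:
  assumes "a \<in> {1..m}" "b \<in> {1..n}"
  shows "c (a, b) \<noteq> miss b"
proof -
  have "c (a, b) \<in> (\<lambda>a. c (a, b)) ` {1..m}" using assms(1) by blast
  then show ?thesis unfolding miss(2)[OF assms(2)] by blast
qed

lemma layer_inj:
  assumes "a \<in> {1..m}" "a' \<in> {1..m}" "b \<in> {1..n}" "c (a, b) = c (a', b)"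
  shows "a = a'"
  using inj_onD[OF proper_coloring_layer_inj[OF proper assms(3)] assms(4)] assms(1,2) by simp

lemma column_proper:
  assumes "a \<in> {1..m}" "b \<in> {1..n}" "b' \<in> {1..n}" "b' = Suc b \<or> b = Suc b'"
  shows "c (a, b) \<noteq> c (a, b')"
proof -
  have "((a, b), (a, b')) \<in> parcs G" using assms by (simp add: parcs_complete_path)
  then show ?thesis using proper unfolding proper_coloring_def by blast
qed

lemma dist_present_color:
  assumes "a \<in> {1..m}" "b \<in> {1..n}" "i \<in> {1..m + 1}" "i \<noteq> miss b"
  shows "dist_to_set G (a, b) (color_class G c i) = (if i = c (a, b) then 0 else 1)"
proof (cases "i = c (a, b)")
  case True
  then show ?thesis
    using dist_color_self[OF pair_graph_complete_path] assms by (simp add: pverts_complete_path)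
next
  case False
  obtain a' where "a' \<in> {1..m}" "c (a', b) = i" using ex_column[OF assms(2-4)] .
  then show ?thesis
    using dist_color_eq_1[OF pair_graph_complete_path, of "(a, b)" "(a', b)" m n c] False assms
    by (auto simp: parcs_complete_path)
qed

lemma same_code_imp_eq:
  assumes "a \<in> {1..m}" "b \<in> {1..n}" "a' \<in> {1..m}" "b' \<in> {1..n}"
    and "\<And>i. i \<in> {1..m + 1} \<Longrightarrow>
      dist_to_set G (a, b) (color_class G c i) = dist_to_set G (a', b') (color_class G c i)"
  shows "(a, b) = (a', b')"
proof -
  have "color_code G (m + 1) c (a, b) = color_code G (m + 1) c (a', b')"
    unfolding color_code_eq_iff using assms(5) by blast
  moreover have "inj_on (color_code G (m + 1) c) (pverts G)"
    using loc by (simp add: locating_coloring_def)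
  moreover have "(a, b) \<in> pverts G" "(a', b') \<in> pverts G"
    using assms(1-4) by (auto simp: pverts_complete_path)
  ultimately show ?thesis by (simp only: inj_on_eq_iff)
qed

text \<open>These are vertices at distance exactly 2 from the colour missing in their layer
  (\<open>dist_far\<close>). Neighbours inside the layer never carry that colour, so only the column
  neighbours are tested; the last conjunct supplies a walk of two arcs.\<close>

definition far :: "nat \<Rightarrow> nat \<Rightarrow> bool" where
  "far a b \<longleftrightarrow> a \<in> {1..m} \<and> b \<in> {1..n} \<and>
    (\<forall>b'\<in>{1..n}. b' = Suc b \<or> b = Suc b' \<longrightarrow> c (a, b') \<noteq> miss b) \<and>
    (\<exists>w u. ((a, b), w) \<in> parcs G \<and> (w, u) \<in> parcs G \<and> c u = miss b)"

lemma dist_far: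
  assumes "far a b"
  shows "dist_to_set G (a, b) (color_class G c (miss b)) = 2"
proof -
  have dom: "a \<in> {1..m}" "b \<in> {1..n}" using assms by (auto simp: far_def)
  obtain w u where wu: "((a, b), w) \<in> parcs G" "(w, u) \<in> parcs G" "c u = miss b"
    using assms unfolding far_def by auto
  have "c (x, y) \<noteq> c u" if "((a, b), (x, y)) \<in> parcs G" for x y
  proof (cases "y = b")
    case True
    then show ?thesis using that c_neq_miss[of x b] wu(3) by (simp add: parcs_complete_path)
  next
    case False
    then have "x = a" "y \<in> {1..n}" "y = Suc b \<or> b = Suc y"
      using that by (auto simp: parcs_complete_path)
    moreover have "\<forall>b'\<in>{1..n}. b' = Suc b \<or> b = Suc b' \<longrightarrow> c (a, b') \<noteq> miss b"
      using assms unfolding far_def by (elim conjE)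
    ultimately show ?thesis unfolding wu(3) by blast
  qed
  then have "c x \<noteq> c u" if "((a, b), x) \<in> parcs G" for x
    using that by (cases x) simp
  moreover have "c (a, b) \<noteq> c u" using c_neq_miss[OF dom] wu(3) by simp
  ultimately show ?thesis
    using dist_color_eq_2[OF pair_graph_complete_path wu(1,2), of c] wu(3) by simp
qed

text \<open>The code of a far vertex is 0 at its own colour, 2 at the missing one and 1 elsewhere,
  so these two colours determine it.\<close>

lemma far_unique:
  assumes "far a b" "far a' b'" "c (a, b) = c (a', b')" "miss b = miss b'"
  shows "b = b'"
proof -
  have dom: "a \<in> {1..m}" "b \<in> {1..n}" "a' \<in> {1..m}" "b' \<in> {1..n}"
    using assms(1,2) by (auto simp: far_def)
  have "(a, b) = (a', b')"
  proof (rule same_code_imp_eq[OF dom])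
    fix i assume i: "i \<in> {1..m + 1}"
    show "dist_to_set G (a, b) (color_class G c i) = dist_to_set G (a', b') (color_class G c i)"
      using dist_far[OF assms(1)] dist_far[OF assms(2)] dist_present_color[OF dom(1,2) i]
        dist_present_color[OF dom(3,4) i] assms(3,4)
      by (cases "i = miss b") auto
  qed
  then show ?thesis by simp
qed

text \<open>The walk of two arcs goes inside layer \<open>b\<close> to column \<open>y\<close> and
  then on to \<open>(y, b')\<close>; it exists because \<open>a\<close> and \<open>y\<close> must
  differ.\<close>

lemma farI:
  assumes "a \<in> {1..m}" "b \<in> {1..n}"
    and "\<And>b'. b' \<in> {1..n} \<Longrightarrow> b' = Suc b \<or> b = Suc b' \<Longrightarrow> c (a, b') \<noteq> miss b"
    and "b' \<in> {1..n}" "b' = Suc b \<or> b = Suc b'" "y \<in> {1..m}" "c (y, b') = miss b"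
  shows "far a b"
proof -
  have "a \<noteq> y" using assms(3)[OF assms(4,5)] assms(7) by auto
  then have "((a, b), (y, b)) \<in> parcs G" "((y, b), (y, b')) \<in> parcs G"
    using assms by (auto simp: parcs_complete_path)
  then have "\<exists>w u. ((a, b), w) \<in> parcs G \<and> (w, u) \<in> parcs G \<and> c u = miss b"
    using assms(7) by (intro exI[of _ "(y, b)"] exI[of _ "(y, b')"]) simp
  moreover have "\<forall>b'\<in>{1..n}. b' = Suc b \<or> b = Suc b' \<longrightarrow> c (a, b') \<noteq> miss b"
    using assms(3) by simp
  ultimately show ?thesis using assms(1,2) unfolding far_def by simp
qed

text \<open>Here \<open>q\<close> lies between \<open>p\<close> and \<open>r\<close>, in either
  orientation, so the lemma serves to move both up and down. If \<open>r\<close> showed the colour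
  missing in \<open>p\<close> and \<open>q\<close>, equally coloured far vertices would exist in
  \<open>p\<close> and in \<open>q\<close>, against \<open>far_unique\<close>.\<close>

lemma miss_spread:
  assumes dom: "p \<in> {1..n}" "q \<in> {1..n}" "r \<in> {1..n}"
    and pq: "p = Suc q \<or> q = Suc p" and qr: "q = Suc r \<or> r = Suc q" and "p \<noteq> r"
    and eq: "miss p = miss q"
  shows "miss r = miss q"
proof (rule ccontr)
  assume neq: "miss r \<noteq> miss q"
  obtain y where y: "y \<in> {1..m}" "c (y, r) = miss q"
    using ex_column[OF dom(3) miss(1)[OF dom(2)]] neq by metis
  \<comment> \<open>Layer \<open>p\<close> misses the colour and layer \<open>r\<close> shows it
    only in column \<open>y\<close>, so all other vertices of layer \<open>q\<close> are
    far.\<close>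
  have far_q: "far z q" if "z \<in> {1..m}" "z \<noteq> y" for z
  proof (rule farI[OF that(1) dom(2) _ dom(3) _ y])
    show "r = Suc q \<or> q = Suc r" using qr by auto
    fix b' assume "b' \<in> {1..n}" "b' = Suc q \<or> q = Suc b'"
    then have "b' = p \<or> b' = r" using pq qr \<open>p \<noteq> r\<close> by auto
    then show "c (z, b') \<noteq> miss q"
      using c_neq_miss[OF that(1) dom(1)] eq layer_inj[OF that(1) y(1) dom(3)] y(2) that(2) by auto
  qed
  show False
  \<comment> \<open>The distinction is whether the layer on the other side of \<open>p\<close>
    exists and shows the missing colour.\<close>
  proof (cases "\<exists>s\<in>{1..n}. (s = Suc p \<or> p = Suc s) \<and> s \<noteq> q \<and> miss s \<noteq> miss q")
    case True
    then obtain s where s: "s \<in> {1..n}" "s = Suc p \<or> p = Suc s" "s \<noteq> q" "miss s \<noteq> miss q"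
      by blast
    obtain x where x: "x \<in> {1..m}" "c (x, s) = miss p"
      using ex_column[OF s(1) miss(1)[OF dom(1)]] s(4) eq by metis
    have far_p: "far z p" if "z \<in> {1..m}" "z \<noteq> x" for z
    proof (rule farI[OF that(1) dom(1) _ s(1,2) x])
      fix b' assume "b' \<in> {1..n}" "b' = Suc p \<or> p = Suc b'"
      then have "b' = q \<or> b' = s" using pq s(2,3) by auto
      then show "c (z, b') \<noteq> miss p"
        using c_neq_miss[OF that(1) dom(2)] eq layer_inj[OF that(1) x(1) s(1)] x(2) that(2) by auto
    qed
    \<comment> \<open>At least four colours are available because \<open>m\<close> is at least 3.
      One that avoids these three belongs to far vertices in both layers.\<close>
    have "\<not> {1..m + 1} \<subseteq> {miss q, c (x, p), c (y, q)}"
    proof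
      assume "{1..m + 1} \<subseteq> {miss q, c (x, p), c (y, q)}"
      then have "card {1..m + 1} \<le> card {miss q, c (x, p), c (y, q)}" by (intro card_mono) auto
      also have "\<dots> \<le> 3" by (simp add: card_insert_if)
      finally show False using m_ge by simp
    qed
    then obtain i where i: "i \<in> {1..m + 1}" "i \<noteq> miss q" "i \<noteq> c (x, p)" "i \<noteq> c (y, q)"
      by blast
    obtain z where z: "z \<in> {1..m}" "c (z, p) = i" using ex_column[OF dom(1) i(1)] i(2) eq by metis
    obtain z' where z': "z' \<in> {1..m}" "c (z', q) = i" using ex_column[OF dom(2) i(1,2)] .
    have "z \<noteq> x" "z' \<noteq> y" using z z' i by blast+
    then have "p = q"
      using far_unique[OF far_p[OF z(1)] far_q[OF z'(1)]] z z' eq by simp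
    then show False using pq by auto
  next
    case False
    \<comment> \<open>No layer next to \<open>p\<close> shows the missing colour, so
      \<open>(y, p)\<close> is far: it reaches that colour through \<open>(y, q)\<close> and
      \<open>(y, r)\<close>.\<close>
    have far_y: "far y p"
      unfolding far_def
    proof (intro conjI ballI impI)
      show "y \<in> {1..m}" "p \<in> {1..n}" by fact+
      fix b' assume b': "b' \<in> {1..n}" "b' = Suc p \<or> p = Suc b'"
      then have "miss b' = miss q" using False by blast
      then show "c (y, b') \<noteq> miss p" using c_neq_miss[OF y(1) b'(1)] eq by simp
    next
      have "((y, p), (y, q)) \<in> parcs G" "((y, q), (y, r)) \<in> parcs G"
        using y(1) dom pq qr by (auto simp: parcs_complete_path)
      then show "\<exists>w u. ((y, p), w) \<in> parcs G \<and> (w, u) \<in> parcs G \<and> c u = miss p"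
        using y(2) eq by auto
    qed
    obtain z where z: "z \<in> {1..m}" "c (z, q) = c (y, p)"
      using ex_column[OF dom(2) c_range[OF y(1) dom(1)]] c_neq_miss[OF y(1) dom(1)] eq by metis
    \<comment> \<open>The colour of \<open>(y, p)\<close> cannot recur at its neighbour
      \<open>(y, q)\<close>, so its occurrence in layer \<open>q\<close> is at a far vertex.\<close>
    have "z \<noteq> y" using column_proper[OF y(1) dom(1,2)] pq z(2) by auto
    then have "p = q" using far_unique[OF far_y far_q[OF z(1)]] z(2) eq by simp
    then show False using pq by auto
  qed
qed

text \<open>From two equal consecutive values \<open>miss_spread\<close> propagates the value to all
  layers; that colour would then be absent from the graph, although the colouring is onto.\<close>

lemma miss_Suc_neq:
  assumes "1 \<le> b" "Suc b \<le> n"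
  shows "miss b \<noteq> miss (Suc b)"
proof
  assume eq: "miss b = miss (Suc b)"
  \<comment> \<open>Each layer follows from the two before it, hence the two base cases.\<close>
  have up: "b + d \<le> n \<Longrightarrow> miss (b + d) = miss b" for d
  proof (induction d rule: less_induct)
    case (less d)
    consider "d = 0" | "d = 1" | e where "d = Suc (Suc e)" by (metis One_nat_def not0_implies_Suc)
    then show ?case
    proof cases
      case 3
      then show ?thesis
        using less.IH[of e] less.IH[of "Suc e"] less.prems assms
          miss_spread[of "b + e" "b + Suc e" "b + d"] by auto
    qed (use eq in auto)
  qed
  have down: "d < b \<Longrightarrow> miss (b - d) = miss b" for d
  proof (induction d rule: less_induct)
    case (less d)
    consider "d = 0" | "d = 1" | e where "d = Suc (Suc e)" by (metis One_nat_def not0_implies_Suc)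
    then show ?case
    proof cases
      \<comment> \<open>The first step down starts from the layers \<open>Suc b\<close> and
        \<open>b\<close>.\<close>
      case 2
      then have "Suc b \<noteq> b - d" "b - d \<in> {1..n}" "b = Suc (b - d)"
        using assms less.prems by auto
      then show ?thesis
        using miss_spread[of "Suc b" b "b - d"] eq assms by auto
    next
      case 3
      then have "b - e \<in> {1..n}" "b - Suc e \<in> {1..n}" "b - d \<in> {1..n}"
        "b - e = Suc (b - Suc e)" "b - Suc e = Suc (b - d)" "b - e \<noteq> b - d"
        using assms less.prems by auto
      then show ?thesis
        using less.IH[of e] less.IH[of "Suc e"] less.prems 3
          miss_spread[of "b - e" "b - Suc e" "b - d"] by auto
    qed auto
  qed
  have const: "miss b' = miss b" if "b' \<in> {1..n}" for b'
    using up[of "b' - b"] down[of "b - b'"] that by (cases "b \<le> b'") auto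
  have "miss b \<in> c ` pverts G"
    using proper miss(1)[of b] assms unfolding proper_coloring_def by auto
  then show False
    using c_neq_miss const by (force simp: pverts_complete_path)
qed

text \<open>A neighbouring layer misses a different colour and so shows \<open>miss b\<close>; the
  vertex of layer \<open>b\<close> in the same column is adjacent to it.\<close>

lemma ex_seeing_all:
  assumes b: "b \<in> {1..n}"
  shows "\<exists>a\<in>{1..m}. \<forall>i\<in>{1..m + 1}.
    dist_to_set G (a, b) (color_class G c i) = (if i = c (a, b) then 0 else 1)"
proof -
  obtain b' where b': "b' \<in> {1..n}" "b' = Suc b \<or> b = Suc b'" "miss b' \<noteq> miss b"
  proof (cases "b = n")
    case True
    then have "b - 1 \<in> {1..n}" "b = Suc (b - 1)" using n_ge by auto
    moreover from this have "miss (b - 1) \<noteq> miss b" using miss_Suc_neq[of "b - 1"] b by auto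
    ultimately show thesis using that by blast
  next
    case False
    then have "Suc b \<in> {1..n}" using b by auto
    moreover from this have "miss (Suc b) \<noteq> miss b" using miss_Suc_neq[of b] b by auto
    ultimately show thesis using that by blast
  qed
  obtain a where a: "a \<in> {1..m}" "c (a, b') = miss b"
    using ex_column[OF b'(1) miss(1)[OF b]] b'(3) by metis
  have "((a, b), (a, b')) \<in> parcs G" using a b b' by (auto simp: parcs_complete_path)
  then have "dist_to_set G (a, b) (color_class G c (miss b)) = 1"
    using dist_color_eq_1[OF pair_graph_complete_path, of "(a, b)" "(a, b')" m n c]
      c_neq_miss[OF a(1) b] a(2) by simp
  then have "dist_to_set G (a, b) (color_class G c i) = (if i = c (a, b) then 0 else 1)"
    if "i \<in> {1..m + 1}" for i
    using dist_present_color[OF a(1) b that] c_neq_miss[OF a(1) b] by (cases "i = miss b") auto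
  then show ?thesis using a(1) by blast
qed

text \<open>The vertices from \<open>ex_seeing_all\<close>, one per layer, have codes determined by
  their own colours, so these \<open>n\<close> colours are distinct.\<close>

lemma n_le: "n \<le> m + 1"
proof -
  have "\<forall>b\<in>{1..n}. \<exists>a. a \<in> {1..m} \<and> (\<forall>i\<in>{1..m + 1}.
      dist_to_set G (a, b) (color_class G c i) = (if i = c (a, b) then 0 else 1))"
    using ex_seeing_all by blast
  from bchoice[OF this] obtain x where x: "\<And>b. b \<in> {1..n} \<Longrightarrow> x b \<in> {1..m}"
    "\<And>b i. b \<in> {1..n} \<Longrightarrow> i \<in> {1..m + 1} \<Longrightarrow>
      dist_to_set G (x b, b) (color_class G c i) = (if i = c (x b, b) then 0 else 1)"
    by blast
  have "inj_on (\<lambda>b. c (x b, b)) {1..n}"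
  proof (rule inj_onI)
    fix b b' assume b: "b \<in> {1..n}" "b' \<in> {1..n}" "c (x b, b) = c (x b', b')"
    have "(x b, b) = (x b', b')"
      using x b by (intro same_code_imp_eq) auto
    then show "b = b'" by simp
  qed
  moreover have "(\<lambda>b. c (x b, b)) ` {1..n} \<subseteq> {1..m + 1}"
    using c_range x(1) by blast
  ultimately show ?thesis
    using card_inj_on_le[of "\<lambda>b. c (x b, b)" "{1..n}" "{1..m + 1}"] by simp
qed

end

section \<open>Colourings attaining the bounds\<close>

text \<open>
  Layer \<open>b\<close> misses exactly the residue \<open>b\<close> modulo \<open>m + 1\<close>, and
  the columns of index below 3 are rotated so that the two neighbouring layers place that residue
  in the same column, next to the residue \<open>b + 2\<close>.
\<close>

definition offset :: "nat \<Rightarrow> nat \<Rightarrow> nat \<Rightarrow> nat" where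
  "offset m a b =
    (if a - 1 = b mod 3 then 2
     else if a - 1 = (b + 1) mod 3 then 1
     else if a - 1 = (b + 2) mod 3 then m
     else a - 1)"

definition short_coloring :: "nat \<Rightarrow> nat \<times> nat \<Rightarrow> nat" where
  "short_coloring m = (\<lambda>(a, b). Suc ((b + offset m a b) mod (m + 1)))"

section \<open>Arithmetic of the offsets\<close>

lemma mod_3_cases:
  fixes b :: nat
  shows "b mod 3 = 0 \<and> (b + 1) mod 3 = 1 \<and> (b + 2) mod 3 = 2 \<and> (b + 3) mod 3 = 0
    \<or> b mod 3 = 1 \<and> (b + 1) mod 3 = 2 \<and> (b + 2) mod 3 = 0 \<and> (b + 3) mod 3 = 1
    \<or> b mod 3 = 2 \<and> (b + 1) mod 3 = 0 \<and> (b + 2) mod 3 = 1 \<and> (b + 3) mod 3 = 2"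
proof -
  have "b mod 3 = 0 \<or> b mod 3 = 1 \<or> b mod 3 = 2" by linarith
  then show ?thesis by (elim disjE) (simp_all add: mod_Suc add_2_eq_Suc')
qed

text \<open>The table of offsets for columns counted from 0, which turns the later proofs into
  finite case splits.\<close>

lemma offset_Suc:
  "offset m (Suc x) b =
    (if b mod 3 = 0 then (if x = 0 then 2 else if x = 1 then 1 else if x = 2 then m else x)
     else if b mod 3 = 1 then (if x = 1 then 2 else if x = 2 then 1 else if x = 0 then m else x)
     else (if x = 2 then 2 else if x = 0 then 1 else if x = 1 then m else x))"
  using mod_3_cases[of b] by (elim disjE conjE) (simp_all only: offset_def, simp_all)

lemma offset_range:
  assumes "m \<ge> 3" "a \<in> {1..m}"
  shows "offset m a b \<in> {1..m}"
proof -
  obtain x where "a = Suc x" "x < m" using assms(2) by (cases a) auto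
  then show ?thesis
    using assms(1) by (auto simp: offset_Suc)
qed

text \<open>The three rotated columns receive 1, 2 and \<open>m\<close>, the others the values from
  3 to \<open>m - 1\<close>.\<close>

lemma offset_inj:
  assumes "m \<ge> 3" "a \<in> {1..m}" "a' \<in> {1..m}" "offset m a b = offset m a' b"
  shows "a = a'"
proof -
  obtain x x' where x: "a = Suc x" "x < m" "a' = Suc x'" "x' < m"
    using assms(2,3) by (cases a; cases a') auto
  have "b mod 3 = 0 \<or> b mod 3 = 1 \<or> b mod 3 = 2" by linarith
  moreover have "x = 0 \<or> x = 1 \<or> x = 2 \<or> x \<ge> 3" by linarith
  moreover have "x' = 0 \<or> x' = 1 \<or> x' = 2 \<or> x' \<ge> 3" by linarith
  ultimately have "x = x'"
    using assms(1,4) x(2,4) unfolding x(1,3) offset_Suc by (elim disjE) simp_all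
  then show ?thesis unfolding x(1,3) by simp
qed

lemma offset_eq_1_iff:
  assumes "m \<ge> 3" "a \<in> {1..m}"
  shows "offset m a b = 1 \<longleftrightarrow> a - 1 = (b + 1) mod 3"
proof -
  obtain x where "a = Suc x" "x < m" using assms(2) by (cases a) auto
  then show ?thesis
    using assms(1) mod_3_cases[of b]
    by (elim disjE conjE) (auto simp: offset_Suc split: if_splits)
qed

lemma offset_eq_m_iff:
  assumes "m \<ge> 3" "a \<in> {1..m}"
  shows "offset m a b = m \<longleftrightarrow> a - 1 = (b + 2) mod 3"
proof -
  obtain x where "a = Suc x" "x < m" using assms(2) by (cases a) auto
  then show ?thesis
    using assms(1) mod_3_cases[of b]
    by (elim disjE conjE) (auto simp: offset_Suc split: if_splits)
qed

text \<open>A rotated column runs through the cycle 2, \<open>m\<close>, 1 as the layer increases;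
  any other keeps its offset.\<close>

lemma offset_Suc_cases:
  assumes "m \<ge> 3" "a \<in> {1..m}"
  shows "offset m a b = 2 \<and> offset m a (Suc b) = m \<or> offset m a b = 1 \<and> offset m a (Suc b) = 2 \<or>
    offset m a b = m \<and> offset m a (Suc b) = 1 \<or> offset m a (Suc b) = offset m a b"
proof -
  obtain x where "a = Suc x" "x < m" using assms(2) by (cases a) auto
  then show ?thesis
    using assms(1) mod_3_cases[of b]
    by (elim disjE conjE) (simp_all add: offset_Suc)
qed

section \<open>The colouring with \<open>m + 1\<close> colours\<close>

lemma short_coloring_layer:
  assumes "m \<ge> 3"
  shows "inj_on (\<lambda>a. short_coloring m (a, b)) {1..m}"
    and "(\<lambda>a. short_coloring m (a, b)) ` {1..m} = {1..m + 1} - {Suc (b mod (m + 1))}"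
proof -
  show inj: "inj_on (\<lambda>a. short_coloring m (a, b)) {1..m}"
  proof (rule inj_onI, rule ccontr)
    fix a a' assume a: "a \<in> {1..m}" "a' \<in> {1..m}"
      and eq: "short_coloring m (a, b) = short_coloring m (a', b)" and "a \<noteq> a'"
    then have "offset m a b \<noteq> offset m a' b" using offset_inj[OF assms a] by auto
    then show False
      using mod_neq_of_less[of "b + offset m a b" "b + offset m a' b" "m + 1"]
        mod_neq_of_less[of "b + offset m a' b" "b + offset m a b" "m + 1"]
        offset_range[OF assms a(1), of b] offset_range[OF assms a(2), of b] eq
      by (fastforce simp: short_coloring_def neq_iff)
  qed
  have "(b + offset m a b) mod (m + 1) \<noteq> b mod (m + 1)" if "a \<in> {1..m}" for a
    using mod_neq_of_less[of b "b + offset m a b" "m + 1"] offset_range[OF assms that, of b] by auto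
  moreover have "x mod (m + 1) \<le> m" for x
    using mod_less_divisor[of "m + 1" x] by simp
  ultimately show "(\<lambda>a. short_coloring m (a, b)) ` {1..m} = {1..m + 1} - {Suc (b mod (m + 1))}"
    by (intro image_eq_insert_missing inj) (auto simp: short_coloring_def)
qed

lemma short_coloring_Suc_neq:
  assumes "m \<ge> 3" "a \<in> {1..m}"
  shows "short_coloring m (a, b) \<noteq> short_coloring m (a, Suc b)"
  using offset_Suc_cases[OF assms, of b] assms
    mod_neq_of_less[of "b + offset m a b" "Suc b + offset m a (Suc b)" "m + 1"]
    mod_neq_of_less[of "Suc b + offset m a (Suc b)" "b + offset m a b" "m + 1"]
  by (auto simp: short_coloring_def)

text \<open>Residue \<open>b\<close> arises in layer \<open>b + 1\<close> from offset
  \<open>m\<close> and in layer \<open>b - 1\<close> from offset 1; the rotation puts both in the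
  same column.\<close>

lemma short_coloring_eq_missing_iff:
  assumes "m \<ge> 3" "a \<in> {1..m}" "b' = Suc b \<or> b = Suc b'"
  shows "short_coloring m (a, b') = Suc (b mod (m + 1)) \<longleftrightarrow> a - 1 = b mod 3"
  using assms(3)
proof
  assume b': "b' = Suc b"
  have range: "offset m a b' \<in> {1..m}" by (rule offset_range[OF assms(1,2)])
  have "(b' + offset m a b') mod (m + 1) = b mod (m + 1) \<longleftrightarrow> offset m a b' = m"
  proof
    assume "offset m a b' = m"
    then have "b' + offset m a b' = b + (m + 1)" using b' by simp
    then show "(b' + offset m a b') mod (m + 1) = b mod (m + 1)" by (simp only: mod_add_self2)
  next
    assume "(b' + offset m a b') mod (m + 1) = b mod (m + 1)"
    then show "offset m a b' = m"
      using mod_neq_of_less[of b "b' + offset m a b'" "m + 1"] b' range by fastforce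
  qed
  moreover have "(b' + 2) mod 3 = b mod 3" using b' by presburger
  ultimately show ?thesis
    using offset_eq_m_iff[OF assms(1,2), of b'] by (simp add: short_coloring_def)
next
  assume b: "b = Suc b'"
  have range: "offset m a b' \<in> {1..m}" by (rule offset_range[OF assms(1,2)])
  have "(b' + offset m a b') mod (m + 1) = b mod (m + 1) \<longleftrightarrow> offset m a b' = 1"
    using mod_neq_of_less[of b "b' + offset m a b'" "m + 1"] b range by fastforce
  then show ?thesis
    using offset_eq_1_iff[OF assms(1,2), of b'] b by (simp add: short_coloring_def)
qed

text \<open>Outside the special column, \<open>(a, b)\<close> has distance at least 2 from the
  colour missing in its layer. Since \<open>n\<close> is at most \<open>m + 1\<close>, layer
  \<open>b'\<close> misses another colour, so \<open>(a', b')\<close> has distance 1 from that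
  one.\<close>

lemma short_coloring_column:
  assumes m: "m \<ge> 3" and dom: "a \<in> {1..m}" "b \<in> {1..n}" "a' \<in> {1..m}" "b' \<in> {1..n}"
    and "n \<le> m + 1" "b \<noteq> b'"
    and same: "short_coloring m (a, b) = short_coloring m (a', b')"
    and code: "color_code (complete_graph m \<box> path_graph n) (m + 1) (short_coloring m) (a, b) =
      color_code (complete_graph m \<box> path_graph n) (m + 1) (short_coloring m) (a', b')"
  shows "a - 1 = b mod 3"
proof (rule ccontr)
  let ?G = "complete_graph m \<box> path_graph n" and ?c = "short_coloring m" and ?j = "Suc (b mod (m + 1))"
  assume nsp: "a - 1 \<noteq> b mod 3"
  have j: "?j \<in> {1..m + 1}" using mod_less_divisor[of "m + 1" b] by simp
  have ne: "?c (x, b) \<noteq> ?j" if "x \<in> {1..m}" for x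
    using short_coloring_layer(2)[OF m, of b] imageI[OF that, of "\<lambda>x. ?c (x, b)"] by auto
  have "b mod (m + 1) \<noteq> b' mod (m + 1)"
    using mod_neq_of_less[of b b' "m + 1"] mod_neq_of_less[of b' b "m + 1"] assms by fastforce
  then have "?j \<in> (\<lambda>x. ?c (x, b')) ` {1..m}"
    using short_coloring_layer(2)[OF m, of b'] j by simp
  then obtain x where x: "x \<in> {1..m}" "?c (x, b') = ?j" by auto
  have "?c (a', b') \<noteq> ?j" using ne[OF dom(1)] same by simp
  then have "dist_to_set ?G (a', b') (color_class ?G ?c ?j) = 1"
    using dist_color_eq_1[OF pair_graph_complete_path, of "(a', b')" "(x, b')" m n ?c] x dom
    by (auto simp: parcs_complete_path)
  moreover have "2 \<le> dist_to_set ?G (a, b) (color_class ?G ?c ?j)"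
  proof (rule dist_color_ge_2[OF pair_graph_complete_path])
    have "(x, b') \<in> color_class ?G ?c ?j"
      using x dom by (simp add: color_class_def pverts_complete_path)
    then show "color_class ?G ?c ?j \<noteq> {}" by blast
    show "?c (a, b) \<noteq> ?j" by (rule ne[OF dom(1)])
    fix u assume "((a, b), u) \<in> parcs ?G"
    then show "?c u \<noteq> ?j"
      using ne short_coloring_eq_missing_iff[OF m dom(1), of _ b] nsp
      by (cases u) (auto simp: parcs_complete_path)
  qed
  ultimately show False
    using code j unfolding color_code_eq_iff by fastforce
qed

lemma locating_short_coloring:
  assumes m: "m \<ge> 3" and "n \<ge> 2" "n \<le> m + 1"
  shows "locating_coloring (complete_graph m \<box> path_graph n) (m + 1) (short_coloring m)"
proof -
  let ?G = "complete_graph m \<box> path_graph n" and ?c = "short_coloring m"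
  have "?c ` pverts ?G = (\<Union>b\<in>{1..n}. (\<lambda>a. ?c (a, b)) ` {1..m})"
    unfolding pverts_complete_path by auto
  also have "\<dots> = {1..m + 1}"
  proof
    show "{1..m + 1} \<subseteq> (\<Union>b\<in>{1..n}. (\<lambda>a. ?c (a, b)) ` {1..m})"
    proof
      fix i assume "i \<in> {1..m + 1}"
      \<comment> \<open>Layers 1 and 2 miss different colours, so together they show all.\<close>
      moreover have "Suc (1 mod (m + 1)) \<noteq> Suc (2 mod (m + 1))" using m by simp
      ultimately obtain b where "b \<in> {1, 2}" "i \<in> {1..m + 1} - {Suc (b mod (m + 1))}" by blast
      then show "i \<in> (\<Union>b\<in>{1..n}. (\<lambda>a. ?c (a, b)) ` {1..m})"
        unfolding short_coloring_layer(2)[OF m] using assms by (intro UN_I[of b]) auto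
    qed
  qed (unfold short_coloring_layer(2)[OF m], blast)
  finally have onto: "?c ` pverts ?G = {1..m + 1}" .
  have "?c (a, b) \<noteq> ?c (a', b')" if "((a, b), (a', b')) \<in> parcs ?G" for a b a' b'
    using that short_coloring_Suc_neq[OF m, of a b] short_coloring_Suc_neq[OF m, of a b']
      inj_onD[OF short_coloring_layer(1)[OF m, of b], of a a']
    by (auto simp: parcs_complete_path)
  then have proper: "proper_coloring ?G (m + 1) ?c"
    using onto unfolding proper_coloring_def by auto
  have "inj_on (color_code ?G (m + 1) ?c) (pverts ?G)"
  proof (rule inj_onI)
    fix u v assume uv: "u \<in> pverts ?G" "v \<in> pverts ?G"
      and code: "color_code ?G (m + 1) ?c u = color_code ?G (m + 1) ?c v"
    obtain a b a' b' where ab: "u = (a, b)" "v = (a', b')" by fastforce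
    have dom: "a \<in> {1..m}" "b \<in> {1..n}" "a' \<in> {1..m}" "b' \<in> {1..n}"
      using uv unfolding ab pverts_complete_path by auto
    have same: "?c (a, b) = ?c (a', b')"
      using color_eq_of_code_eq[OF pair_graph_complete_path proper uv code] unfolding ab .
    have "b = b'"
    proof (rule ccontr)
      assume neq: "b \<noteq> b'"
      have "a - 1 = b mod 3"
        using short_coloring_column[OF m dom assms(3) neq same] code unfolding ab .
      moreover have "a' - 1 = b' mod 3"
        using short_coloring_column[OF m dom(3,4,1,2) assms(3) neq[symmetric] same[symmetric]]
          code[symmetric] unfolding ab .
      \<comment> \<open>Both vertices lie in the special columns of their layers, whose colours are
        the residues \<open>b + 2\<close> and \<open>b' + 2\<close>.\<close>
      ultimately have "offset m a b = 2" "offset m a' b' = 2" by (auto simp: offset_def)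
      then have "(b + 2) mod (m + 1) = (b' + 2) mod (m + 1)"
        using same by (simp add: short_coloring_def)
      then show False
        using mod_neq_of_less[of "b + 2" "b' + 2" "m + 1"] mod_neq_of_less[of "b' + 2" "b + 2" "m + 1"]
          neq dom assms(3) by fastforce
    qed
    then show "u = v"
      using inj_onD[OF short_coloring_layer(1)[OF m, of b], of a a'] same dom ab by auto
  qed
  then show ?thesis using proper unfolding locating_coloring_def by blast
qed

text \<open>The colour \<open>m + 2\<close> is used only once, and the colour missing in layer \<open>b > 1\<close> reappears
  at \<open>(1, b + 1)\<close>.\<close>

definition long_coloring :: "nat \<Rightarrow> nat \<times> nat \<Rightarrow> nat" where
  "long_coloring m = (\<lambda>(a, b). if a = 1 \<and> b = 1 then m + 2 else Suc ((a + m * b) mod (m + 1)))"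

text \<open>The potential descends by moving first to column 1 and then down that column.\<close>

lemma dist_to_corner:
  assumes "m \<ge> 1" "n \<ge> 1" "a \<in> {1..m}" "b \<in> {1..n}"
  shows "dist_to_set (complete_graph m \<box> path_graph n) (a, b) {(1, 1)} =
    ereal (real (b - 1 + (if a = 1 then 0 else 1)))"
proof -
  let ?G = "complete_graph m \<box> path_graph n"
  define \<phi> :: "nat \<times> nat \<Rightarrow> nat" where "\<phi> = (\<lambda>(a, b). b - 1 + (if a = 1 then 0 else 1))"
  have "dist_to_set ?G (a, b) {(1, 1)} = ereal (real (\<phi> (a, b)))"
  proof (rule dist_to_set_eq_potential[OF pair_graph_complete_path])
    show "(a, b) \<in> pverts ?G" using assms by (simp add: pverts_complete_path)
    fix u assume u: "u \<in> pverts ?G"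
    obtain x y where xy: "u = (x, y)" by fastforce
    have dom: "x \<in> {1..m}" "y \<in> {1..n}" using u unfolding xy pverts_complete_path by auto
    show "\<phi> u = 0 \<longleftrightarrow> u \<in> {(1, 1)}" using dom unfolding xy \<phi>_def by auto
    assume pos: "\<phi> u > 0"
    show "\<exists>w. (u, w) \<in> parcs ?G \<and> \<phi> w < \<phi> u"
    proof (cases "x = 1")
      case True
      then have "(u, (x, y - 1)) \<in> parcs ?G \<and> \<phi> (x, y - 1) < \<phi> u"
        using dom pos unfolding xy parcs_complete_path \<phi>_def by auto
      then show ?thesis by blast
    next
      case False
      then have "(u, (1, y)) \<in> parcs ?G \<and> \<phi> (1, y) < \<phi> u"
        using dom unfolding xy parcs_complete_path \<phi>_def by auto
      then show ?thesis by blast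
    qed
  next
    fix u w assume "(u, w) \<in> parcs ?G"
    then show "\<phi> u \<le> Suc (\<phi> w)"
      by (cases u; cases w) (auto simp: parcs_complete_path \<phi>_def)
  qed simp
  then show ?thesis by (simp add: \<phi>_def)
qed

lemma long_coloring_layer:
  assumes "m \<ge> 1" "b \<ge> 2"
  shows "(\<lambda>a. long_coloring m (a, b)) ` {1..m} = {1..m + 1} - {Suc (m * b mod (m + 1))}"
proof -
  have c: "long_coloring m (a, b) = Suc ((a + m * b) mod (m + 1))" for a
    using assms by (simp add: long_coloring_def)
  have "inj_on (\<lambda>a. long_coloring m (a, b)) {1..m}"
  proof (rule inj_onI)
    fix a a' assume "a \<in> {1..m}" "a' \<in> {1..m}" "long_coloring m (a, b) = long_coloring m (a', b)"
    then show "a = a'"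
      using mod_neq_of_less[of "a + m * b" "a' + m * b" "m + 1"]
        mod_neq_of_less[of "a' + m * b" "a + m * b" "m + 1"]
      unfolding c by fastforce
  qed
  moreover have "(a + m * b) mod (m + 1) \<noteq> m * b mod (m + 1)" if "a \<in> {1..m}" for a
    using mod_neq_of_less[of "m * b" "a + m * b" "m + 1"] that by fastforce
  moreover have "x mod (m + 1) \<le> m" for x
    using mod_less_divisor[of "m + 1" x] by simp
  ultimately show ?thesis
    by (intro image_eq_insert_missing) (auto simp: c)
qed

lemma long_coloring_range:
  assumes "(a, b) \<noteq> (1, 1)"
  shows "long_coloring m (a, b) \<in> {1..m + 1}"
  using assms mod_less_divisor[of "m + 1" "a + m * b"] by (auto simp: long_coloring_def)

lemma proper_long_coloring:
  assumes "m \<ge> 1" "n \<ge> 3"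
  shows "proper_coloring (complete_graph m \<box> path_graph n) (m + 2) (long_coloring m)"
proof -
  let ?G = "complete_graph m \<box> path_graph n" and ?c = "long_coloring m"
  have top: "?c (1, 1) = m + 2" by (simp add: long_coloring_def)
  have "?c ` pverts ?G \<subseteq> {1..m + 2}"
  proof
    fix i assume "i \<in> ?c ` pverts ?G"
    then obtain a b where "i = ?c (a, b)" by auto
    then show "i \<in> {1..m + 2}" using long_coloring_range[of a b m] top by (cases "(a, b) = (1, 1)") auto
  qed
  moreover have "{1..m + 2} \<subseteq> ?c ` pverts ?G"
  proof
    fix i assume i: "i \<in> {1..m + 2}"
    show "i \<in> ?c ` pverts ?G"
    proof (cases "i = m + 2")
      case True
      then show ?thesis
        using assms top by (intro image_eqI[of _ _ "(1, 1)"]) (auto simp: pverts_complete_path)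
    next
      case False
      \<comment> \<open>Layers 2 and 3 miss different colours, so they show all of
        \<open>{1..m + 1}\<close>.\<close>
      have "m * 2 mod (m + 1) \<noteq> m * 3 mod (m + 1)"
        using mod_neq_of_less[of "m * 2" "m * 3" "m + 1"] assms by simp
      then have "i \<noteq> Suc (m * 2 mod (m + 1)) \<or> i \<noteq> Suc (m * 3 mod (m + 1))" by simp
      moreover have "i \<in> {1..m + 1}" using i False by auto
      ultimately obtain b :: nat where b: "b \<in> {2, 3}" "i \<in> {1..m + 1} - {Suc (m * b mod (m + 1))}"
        by blast
      then have "i \<in> (\<lambda>a. ?c (a, b)) ` {1..m}"
        using long_coloring_layer[of m b] assms by auto
      then show ?thesis using b(1) assms by (auto simp: pverts_complete_path)
    qed
  qed
  moreover have "?c (a, b) \<noteq> ?c (a', b')" if "((a, b), (a', b')) \<in> parcs ?G" for a b a' b'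
  proof (cases "(a, b) = (1, 1) \<or> (a', b') = (1, 1)")
    case True
    then show ?thesis
      using that top long_coloring_range[of a b m] long_coloring_range[of a' b' m]
      by (auto simp: parcs_complete_path)
  next
    case False
    then have c: "?c (a, b) = Suc ((a + m * b) mod (m + 1))" "?c (a', b') = Suc ((a' + m * b') mod (m + 1))"
      by (auto simp: long_coloring_def)
    \<comment> \<open>Neighbours in a layer differ by less than \<open>m\<close>, neighbours in a
      column by exactly \<open>m\<close>.\<close>
    have "a + m * b < a' + m * b' \<and> a' + m * b' < a + m * b + (m + 1) \<or>
      a' + m * b' < a + m * b \<and> a + m * b < a' + m * b' + (m + 1)"
      using that assms by (auto simp: parcs_complete_path)
    then show ?thesis
      using mod_neq_of_less[of "a + m * b" "a' + m * b'" "m + 1"]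
        mod_neq_of_less[of "a' + m * b'" "a + m * b" "m + 1"] unfolding c by auto
  qed
  ultimately show ?thesis unfolding proper_coloring_def by auto
qed

text \<open>The residue at \<open>(1, b + 1)\<close> is \<open>m * b\<close>, as
  \<open>1 + m * (b + 1)\<close> exceeds it by \<open>m + 1\<close>; reaching it in layer
  \<open>b\<close> would need column 0.\<close>

lemma long_coloring_diagonal_neq:
  assumes "x \<in> {2..m}" "b \<ge> 1"
  shows "long_coloring m (1, Suc b) \<noteq> long_coloring m (x, b)"
proof -
  have "(1 + m * Suc b) mod (m + 1) = m * b mod (m + 1)"
    using mod_add_self2[of "m * b" "m + 1"] by (simp add: ac_simps)
  moreover have "m * b mod (m + 1) \<noteq> (x + m * b) mod (m + 1)"
    using mod_neq_of_less[of "m * b" "x + m * b" "m + 1"] assms by simp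
  ultimately show ?thesis using assms by (simp add: long_coloring_def)
qed

lemma locating_long_coloring:
  assumes "m \<ge> 1" "n \<ge> 3"
  shows "locating_coloring (complete_graph m \<box> path_graph n) (m + 2) (long_coloring m)"
proof -
  let ?G = "complete_graph m \<box> path_graph n" and ?c = "long_coloring m"
  have "color_class ?G ?c (m + 2) \<subseteq> {(1, 1)}"
  proof
    fix u assume "u \<in> color_class ?G ?c (m + 2)"
    then show "u \<in> {(1, 1)}"
      using long_coloring_range[of "fst u" "snd u" m] by (cases u) (auto simp: color_class_def)
  qed
  then have top: "color_class ?G ?c (m + 2) = {(1, 1)}"
    using assms by (auto simp: color_class_def long_coloring_def pverts_complete_path)
  have "inj_on (color_code ?G (m + 2) ?c) (pverts ?G)"
  proof (rule inj_onI)
    fix u v assume uv: "u \<in> pverts ?G" "v \<in> pverts ?G"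
      and code: "color_code ?G (m + 2) ?c u = color_code ?G (m + 2) ?c v"
    obtain a b a' b' where ab: "u = (a, b)" "v = (a', b')" by fastforce
    have dom: "a \<in> {1..m}" "b \<in> {1..n}" "a' \<in> {1..m}" "b' \<in> {1..n}"
      using uv unfolding ab pverts_complete_path by auto
    have same: "?c (a, b) = ?c (a', b')"
      using color_eq_of_code_eq[OF pair_graph_complete_path proper_long_coloring[OF assms] uv code]
      unfolding ab .
    have "dist_to_set ?G (a, b) {(1, 1)} = dist_to_set ?G (a', b') {(1, 1)}"
      using bspec[OF iffD1[OF color_code_eq_iff code], of "m + 2"] top unfolding ab by simp
    then have dist: "b - 1 + (if a = 1 then 0 else 1) = b' - 1 + (if a' = 1 then 0 else 1)"
      using dist_to_corner[of m n] dom assms by simp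
    \<comment> \<open>The coordinate of colour \<open>m + 2\<close> is the distance to the corner.
      Vertices that share it lie in one layer, or one is in column 1 and the other one layer below
      it.\<close>
    consider "b = b'" | "a = 1" "b = Suc b'" "a' \<in> {2..m}" | "a' = 1" "b' = Suc b" "a \<in> {2..m}"
      using dist dom by (auto split: if_splits)
    then show "u = v"
    proof cases
      case 1
      show ?thesis
        using inj_onD[OF proper_coloring_layer_inj[OF proper_long_coloring[OF assms] dom(2)], of a a']
          same dom 1 ab by auto
    next
      case 2
      then show ?thesis using long_coloring_diagonal_neq[of a' m b'] same dom by auto
    next
      case 3
      then show ?thesis using long_coloring_diagonal_neq[of a m b] same dom by auto
    qed
  qed
  then show ?thesis using proper_long_coloring[OF assms] unfolding locating_coloring_def by blast
qed

theorem theorem2: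
  fixes m n :: nat
  assumes "m \<ge> 3" and "n \<ge> 2"
  shows "(m \<le> n - 2 \<longrightarrow> \<chi>\<^sub>L (complete_graph m \<box> path_graph n) = m + 2) \<and>
         (m \<ge> n - 1 \<longrightarrow> \<chi>\<^sub>L (complete_graph m \<box> path_graph n) = m + 1)"
proof -
  let ?G = "complete_graph m \<box> path_graph n"
  have ge: "m + 1 \<le> k" if "\<exists>c. locating_coloring ?G k c" for k
    using that locating_coloring_ge[of m n k] assms by auto
  have "\<chi>\<^sub>L ?G = m + 2" if "m \<le> n - 2"
    unfolding locating_chromatic_number_def
  proof (rule Least_equality)
    \<comment> \<open>The bound \<open>n \<ge> 3\<close> holds because \<open>n\<close> is at least
      \<open>m + 2\<close>.\<close>
    have "locating_coloring ?G (m + 2) (long_coloring m)"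
      using assms that by (intro locating_long_coloring) auto
    then show "\<exists>c. locating_coloring ?G (m + 2) c" by blast
    fix k assume k: "\<exists>c. locating_coloring ?G k c"
    have "k \<noteq> m + 1"
    proof
      assume "k = m + 1"
      then obtain c where "locating_coloring ?G (m + 1) c" using k by auto
      then interpret almost_full_coloring m n c using assms by unfold_locales
      show False using n_le that assms by simp
    qed
    then show "m + 2 \<le> k" using ge[OF k] by simp
  qed
  moreover have "\<chi>\<^sub>L ?G = m + 1" if "m \<ge> n - 1"
    unfolding locating_chromatic_number_def
  proof (rule Least_equality)
    have "locating_coloring ?G (m + 1) (short_coloring m)"
      using assms that by (intro locating_short_coloring) auto
    then show "\<exists>c. locating_coloring ?G (m + 1) c" by blast
  qed (rule ge)
  ultimately show ?thesis by blast
qed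

end
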